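(* Let $F$ be a compact subset of $\mathbb{C}^n$ and let $\mu,\nu\in(0,1]$ be constants. If $F$ is convex and has the $\mu$-Hölder continuity property, then $F$ has the local $\mu$-Hölder continuity property of order $\mu$. If $F$ has the $\nu$-Hölder continuity property at $b\in F$ and $b$ is a star center of $F$, i.e. $tF+(1-t)b\subset F$ for each $t\in[0,1]$, then $F$ has the local $\nu$-Hölder continuity property of order $\nu$ at $b$.
   Context: $\mathcal{L}$ is the set of plurisubharmonic functions $u$ on $\mathbb{C}^n$ for which there is a constant $c_u$ with $u(z)\le\max\{0,\log\|z\|\}+c_u$ for all $z\in\mathbb{C}^n$. For $E\subset\mathbb{C}^n$, $L_E(z)=\sup\{u(z):u\in\mathcal{L},\ u|_E\le0\}$, and for $a\in E$, $\varpi_E(a,\delta)=\sup_{\|z-a\|\le\delta}L_E(z)\in[0,\infty]$. $\bar{\mathbb{B}}(a,r)$ is the closed Euclidean ball and $\bar{\mathbb{B}}(F,\delta)$ the closed $\delta$-neighborhood of $F$. For a compact $F\subset\mathbb{C}^n$, $q>0$ and $\mu\in(0,1]$, $F$ has: - the $\mu$-Hölder continuity property ($\mu$-HCP) at $a\in F$ if there is $C>0$ with $L_F(z)\le C\delta^\mu$ whenever $0<\delta\le1$ and $\|z-a\|\le\delta$; - the $\mu$-HCP if there is $C>0$ with $L_F(z)\le C\delta^\mu$ whenever $0<\delta\le1$ and $z\in\bar{\mathbb{B}}(F,\delta)$; - the local $\mu$-HCP of order $q$ at $a\in F$ if there is $C>0$ with $\varpi_{F\cap\bar{\mathbb{B}}(a,r)}(a,\delta)\le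 C\delta^\mu/r^q$ for all $0<\delta\le1$, $0<r\le1$; - the local $\mu$-HCP of order $q$ if there is $C>0$ with $\varpi_{F\cap\bar{\mathbb{B}}(a,r)}(a,\delta)\le C\delta^\mu/r^q$ for all $a\in F$, $0<\delta\le1$, $0<r\le1$. *)

theory Defs
  imports "HOL-Analysis.Analysis"
begin

definition upper_semicontinuous :: "('a::topological_space \<Rightarrow> ereal) \<Rightarrow> bool" where
  "upper_semicontinuous u \<longleftrightarrow> (\<forall>c. open {x. u x < c})"

text \<open>
  The mean of \<open>u\<close> over the circle of centre \<open>w\<close> and radius \<open>\<rho>\<close>, as the integral of the positive part
  minus the integral of the negative part (\<open>e2ennreal\<close> sends negative values to 0).
  For upper semicontinuous \<open>u < \<infinity>\<close> the integrand is Borel and bounded above, so the first integral is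
  finite; the mean is then the usual one, possibly \<open>-\<infinity>\<close>, and \<open>\<infinity> - \<infinity>\<close> does not occur.
\<close>
definition circle_mean :: "(complex \<Rightarrow> ereal) \<Rightarrow> complex \<Rightarrow> real \<Rightarrow> ereal" where
  "circle_mean u w \<rho> =
     (enn2ereal (\<integral>\<^sup>+\<theta>\<in>{0..2*pi}. e2ennreal (u (w + of_real \<rho> * cis \<theta>)) \<partial>lborel)
      - enn2ereal (\<integral>\<^sup>+\<theta>\<in>{0..2*pi}. e2ennreal (- u (w + of_real \<rho> * cis \<theta>)) \<partial>lborel))
     / ereal (2 * pi)"

text \<open>
  Subharmonicity on the whole plane. As in Hoermander's convention, the constant \<open>-\<infinity>\<close> is allowed,
  which makes \<open>subharmonic or identically -\<infinity>\<close> in the definition of plurisubharmonicity one condition.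
  Allowing \<open>-\<infinity>\<close> in the class below does not change \<open>extremal_fun\<close>, since \<open>0\<close> is always a competitor.
\<close>
definition subharmonic :: "(complex \<Rightarrow> ereal) \<Rightarrow> bool" where
  "subharmonic u \<longleftrightarrow> upper_semicontinuous u \<and> (\<forall>w. u w < \<infinity>) \<and>
     (\<forall>w. \<forall>\<rho>>0. u w \<le> circle_mean u w \<rho>)"

definition plurisubharmonic :: "(complex ^ 'n \<Rightarrow> ereal) \<Rightarrow> bool" where
  "plurisubharmonic u \<longleftrightarrow> upper_semicontinuous u \<and> (\<forall>z. u z < \<infinity>) \<and>
     (\<forall>a b. subharmonic (\<lambda>w. u (a + w *s b)))"

text \<open>At \<open>z = 0\<close> the library convention \<open>ln 0 = 0\<close> is harmless because of the maximum with 0.\<close>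
definition lelong_class :: "(complex ^ 'n \<Rightarrow> ereal) set" where
  "lelong_class = {u. plurisubharmonic u \<and>
     (\<exists>c::real. \<forall>z. u z \<le> ereal (max 0 (ln (norm z)) + c))}"

definition extremal_fun :: "(complex ^ 'n) set \<Rightarrow> complex ^ 'n \<Rightarrow> ereal" where
  "extremal_fun E z = (SUP u \<in> {u \<in> lelong_class. \<forall>x\<in>E. u x \<le> 0}. u z)"

definition extremal_modulus :: "(complex ^ 'n) set \<Rightarrow> complex ^ 'n \<Rightarrow> real \<Rightarrow> ereal" where
  "extremal_modulus E a \<delta> = (SUP z \<in> cball a \<delta>. extremal_fun E z)"

text \<open>
  The closed neighbourhood as a union of closed balls, which for compact \<open>F\<close> is the set of points at
  distance at most \<open>\<delta>\<close>; it is empty for empty \<open>F\<close>, unlike the version with \<open>infdist\<close>.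
\<close>
definition closed_nbhd :: "'a::metric_space set \<Rightarrow> real \<Rightarrow> 'a set" where
  "closed_nbhd F \<delta> = (\<Union>a\<in>F. cball a \<delta>)"

definition HCP_at :: "real \<Rightarrow> (complex ^ 'n) set \<Rightarrow> complex ^ 'n \<Rightarrow> bool" where
  "HCP_at \<mu> F a \<longleftrightarrow> (\<exists>C>0. \<forall>\<delta> z. 0 < \<delta> \<and> \<delta> \<le> 1 \<and> norm (z - a) \<le> \<delta> \<longrightarrow>
     extremal_fun F z \<le> ereal (C * \<delta> powr \<mu>))"

definition HCP :: "real \<Rightarrow> (complex ^ 'n) set \<Rightarrow> bool" where
  "HCP \<mu> F \<longleftrightarrow> (\<exists>C>0. \<forall>\<delta> z. 0 < \<delta> \<and> \<delta> \<le> 1 \<and> z \<in> closed_nbhd F \<delta> \<longrightarrow>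
     extremal_fun F z \<le> ereal (C * \<delta> powr \<mu>))"

definition local_HCP_at :: "real \<Rightarrow> real \<Rightarrow> (complex ^ 'n) set \<Rightarrow> complex ^ 'n \<Rightarrow> bool" where
  "local_HCP_at \<mu> q F a \<longleftrightarrow> (\<exists>C>0. \<forall>\<delta> r. 0 < \<delta> \<and> \<delta> \<le> 1 \<and> 0 < r \<and> r \<le> 1 \<longrightarrow>
     extremal_modulus (F \<inter> cball a r) a \<delta> \<le> ereal (C * \<delta> powr \<mu> / r powr q))"

definition local_HCP :: "real \<Rightarrow> real \<Rightarrow> (complex ^ 'n) set \<Rightarrow> bool" where
  "local_HCP \<mu> q F \<longleftrightarrow> (\<exists>C>0. \<forall>a\<in>F. \<forall>\<delta> r. 0 < \<delta> \<and> \<delta> \<le> 1 \<and> 0 < r \<and> r \<le> 1 \<longrightarrow>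
     extremal_modulus (F \<inter> cball a r) a \<delta> \<le> ereal (C * \<delta> powr \<mu> / r powr q))"

definition star_center :: "'a::real_vector set \<Rightarrow> 'a \<Rightarrow> bool" where
  "star_center F b \<longleftrightarrow> (\<forall>t\<in>{0..1}. (\<lambda>x. t *\<^sub>R x + (1 - t) *\<^sub>R b) ` F \<subseteq> F)"

end

theory Submission
  imports Defs "HOL-Complex_Analysis.Cauchy_Integral_Formula"
begin

text \<open>
  Let \<open>b\<close> be a star center of \<open>F\<close>, let \<open>F\<close> lie in the ball of radius \<open>R \<ge> 1\<close> about \<open>b\<close>, and put
  \<open>t = r / R\<close>. The dilation \<open>x \<mapsto> b + t (x - b)\<close> maps \<open>F\<close> into \<open>F \<inter> cball b r\<close>, and composition with it
  preserves the Lelong class. So the extremal function of \<open>F \<inter> cball b r\<close> at distance \<open>\<delta>\<close> from \<open>b\<close> is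
  at most that of \<open>F\<close> at distance \<open>s = \<delta> R / r\<close> from \<open>b\<close> (\<open>extremal_fun_dilation_le\<close>).

  If \<open>s \<le> 1\<close>, Hoelder continuity at \<open>b\<close> gives \<open>C s\<^sup>\<mu> = C R\<^sup>\<mu> \<delta>\<^sup>\<mu> / r\<^sup>\<mu>\<close>, which is the claim. The dilated point
  may however be far from \<open>F\<close>, where the hypothesis says nothing. There a bound of Bernstein-Walsh type
  takes over: a function of the Lelong class that is at most \<open>C\<close> on the unit ball about \<open>b\<close> is at most
  \<open>C + ln \<parallel>z - b\<parallel>\<close> outside it, and \<open>ln s \<le> s\<^sup>\<mu> / \<mu>\<close>. Hence \<open>(C + 1/\<mu>) s\<^sup>\<mu>\<close> is a bound for every
  \<open>s > 0\<close> (\<open>extremal_fun_power_growth\<close>). Restricted to complex lines through \<open>b\<close>, the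
  Bernstein-Walsh bound is a maximum principle for subharmonic functions of logarithmic growth on the
  exterior of the unit disc (\<open>subharmonic_log_growth\<close>); this is the only step that uses
  plurisubharmonicity beyond its invariance under affine maps.

  The constant depends only on \<open>\<mu>\<close>, \<open>R\<close> and the Hoelder constant at \<open>b\<close>. In a compact convex set every
  point is a star center, \<open>R = max 1 (diameter F)\<close> serves all of them, and the Hoelder property of \<open>F\<close>
  supplies one constant for all points, which makes the local property uniform.
\<close>

section \<open>Upper semicontinuous functions\<close>

lemma upper_semicontinuous_attains_max:
  fixes g :: "'a::topological_space \<Rightarrow> ereal"
  assumes usc: "upper_semicontinuous g" and "compact K" "K \<noteq> {}"
  obtains c where "c \<in> K" "\<And>x. x \<in> K \<Longrightarrow> g x \<le> g c"
proof (rule ccontr)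
  assume "\<not> thesis"
  with that have no_max: "\<exists>x\<in>K. g c < g x" if "c \<in> K" for c
    using \<open>c \<in> K\<close> by (meson not_le)
  \<comment> \<open>Without a maximiser, the open sublevel sets below values taken on \<open>K\<close> cover \<open>K\<close>; the largest of
    finitely many such values is attained at a point of \<open>K\<close> that their sublevel sets miss.\<close>
  have "K \<subseteq> (\<Union>x\<in>K. {y. g y < g x})"
    using no_max by blast
  moreover have "open {y. g y < g x}" for x
    using usc by (simp add: upper_semicontinuous_def)
  ultimately obtain T where T: "T \<subseteq> K" "finite T" "K \<subseteq> (\<Union>x\<in>T. {y. g y < g x})"
    by (meson compactE_image[OF \<open>compact K\<close>])
  with \<open>K \<noteq> {}\<close> have "T \<noteq> {}" by auto
  then have "Max (g ` T) \<in> g ` T" using T by simp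
  then obtain x where x: "x \<in> T" "g x = Max (g ` T)" by auto
  then obtain x' where "x' \<in> T" "g x < g x'" using T by blast
  moreover have "g x' \<le> Max (g ` T)" using \<open>x' \<in> T\<close> T by simp
  ultimately show False using x by simp
qed

text \<open>
  Separating the two summands by a real threshold \<open>q\<close> avoids any discussion of continuity of addition
  at infinite values.
\<close>
lemma upper_semicontinuous_add_continuous:
  fixes v :: "'a::topological_space \<Rightarrow> ereal" and k :: "'a \<Rightarrow> real"
  assumes "upper_semicontinuous v" and k: "continuous_on UNIV k"
  shows "upper_semicontinuous (\<lambda>x. v x + ereal (k x))"
  unfolding upper_semicontinuous_def
proof
  fix c :: ereal
  have "{x. v x + ereal (k x) < c} = (\<Union>q. {x. v x < ereal q} \<inter> {x. ereal (q + k x) < c})"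
  proof (intro equalityI subsetI)
    fix x assume "x \<in> {x. v x + ereal (k x) < c}"
    then obtain d where d: "v x + ereal (k x) < ereal d" "ereal d < c"
      using ereal_dense2 by blast
    then have "v x < ereal (d - k x)" by (cases "v x") auto
    moreover have "ereal (d - k x + k x) < c" using d by simp
    ultimately show "x \<in> (\<Union>q. {x. v x < ereal q} \<inter> {x. ereal (q + k x) < c})" by blast
  next
    fix x assume "x \<in> (\<Union>q. {x. v x < ereal q} \<inter> {x. ereal (q + k x) < c})"
    then obtain q where "v x < ereal q" and qc: "ereal (q + k x) < c" by auto
    then have "v x + ereal (k x) < ereal (q + k x)" by (cases "v x") auto
    with qc show "x \<in> {x. v x + ereal (k x) < c}" by (simp add: less_trans)
  qed
  moreover have "open {x. v x < ereal q}" for q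
    using assms by (simp add: upper_semicontinuous_def)
  moreover have "open {x. ereal (q + k x) < c}" for q
    by (intro open_Collect_less continuous_intros continuous_on_ereal k)
  ultimately show "open {x. v x + ereal (k x) < c}" by (simp add: open_UN open_Int)
qed

section \<open>Means over circles\<close>

text \<open>
  Connects the mean of an extended real function, a difference of two nonnegative Lebesgue integrals,
  with the gauge integral. Passing from \<open>u\<close> to its majorant \<open>k\<close> enlarges the integral of the positive part and
  shrinks that of the negative part; for continuous \<open>k\<close> both are finite, so their difference is the
  ordinary integral.
\<close>
lemma circle_mean_le_integral_mean:
  assumes k: "continuous_on {0..2*pi} k" and I: "(k has_integral I) {0..2*pi}"
    and le: "\<And>\<theta>. \<theta> \<in> {0..2*pi} \<Longrightarrow> u (w + of_real \<rho> * cis \<theta>) \<le> ereal (k \<theta>)"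
  shows "circle_mean u w \<rho> \<le> ereal (I / (2*pi))"
proof -
  let ?S = "{0..2*pi} :: real set"
  define g where "g \<theta> = indicator ?S \<theta> *\<^sub>R k \<theta>" for \<theta>
  define P where "P = (\<integral>\<^sup>+\<theta>. ennreal (g \<theta>) \<partial>lborel)"
  define N where "N = (\<integral>\<^sup>+\<theta>. ennreal (- g \<theta>) \<partial>lborel)"
  have setint: "set_integrable lborel ?S k"
    using k by (rule borel_integrable_atLeastAtMost')
  then have int: "integrable lborel g"
    by (simp add: set_integrable_def g_def[abs_def])
  have "I = integral\<^sup>L lborel g"
    using set_borel_integral_eq_integral(2)[OF setint] I
    by (simp add: set_lebesgue_integral_def g_def[abs_def] integral_unique)
  also have "\<dots> = enn2real P - enn2real N"
    unfolding P_def N_def by (rule real_lebesgue_integral_def[OF int])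
  finally have I_eq: "I = enn2real P - enn2real N" .
  have fin: "P \<noteq> \<infinity>" "N \<noteq> \<infinity>"
    using int unfolding real_integrable_def P_def N_def by auto
  have P_le: "(\<integral>\<^sup>+\<theta>\<in>?S. e2ennreal (u (w + of_real \<rho> * cis \<theta>)) \<partial>lborel) \<le> P"
    unfolding P_def
  proof (rule nn_integral_mono)
    fix \<theta> :: real
    show "e2ennreal (u (w + of_real \<rho> * cis \<theta>)) * indicator ?S \<theta> \<le> ennreal (g \<theta>)"
      using e2ennreal_mono[OF le[of \<theta>]] by (auto simp: g_def split: split_indicator)
  qed
  have N_le: "N \<le> (\<integral>\<^sup>+\<theta>\<in>?S. e2ennreal (- u (w + of_real \<rho> * cis \<theta>)) \<partial>lborel)"
    unfolding N_def
  proof (rule nn_integral_mono)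
    fix \<theta> :: real
    have "e2ennreal (ereal (- k \<theta>)) \<le> e2ennreal (- u (w + of_real \<rho> * cis \<theta>))" if "\<theta> \<in> ?S"
      using le[OF that] ereal_minus_le_minus by (intro e2ennreal_mono) (simp flip: uminus_ereal.simps(1))
    then show "ennreal (- g \<theta>) \<le> e2ennreal (- u (w + of_real \<rho> * cis \<theta>)) * indicator ?S \<theta>"
      by (auto simp: g_def split: split_indicator)
  qed
  have "circle_mean u w \<rho> \<le> (enn2ereal P - enn2ereal N) / ereal (2*pi)"
    unfolding circle_mean_def using P_le N_le
    by (intro ereal_divide_right_mono ereal_minus_mono) (simp_all add: less_eq_ennreal.rep_eq)
  also have "enn2ereal P = ereal (enn2real P)" "enn2ereal N = ereal (enn2real N)"
    using fin by (cases P; cases N; simp)+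
  then have "(enn2ereal P - enn2ereal N) / ereal (2*pi) = ereal (I / (2*pi))"
    by (simp add: I_eq)
  finally show ?thesis .
qed

text \<open>Cauchy's integral formula at the centre, with the contour integral written out in the angle.\<close>
lemma holomorphic_circle_mean:
  fixes f :: "complex \<Rightarrow> complex"
  assumes "f holomorphic_on cball c \<rho>" "0 < \<rho>"
  shows "((\<lambda>\<theta>. f (c + of_real \<rho> * cis \<theta>)) has_integral (of_real (2 * pi) * f c)) {0..2*pi}"
proof -
  have "((\<lambda>u. f u / (u - c)) has_contour_integral (2 * of_real pi * \<i> * f c)) (circlepath c \<rho>)"
    using assms by (intro Cauchy_integral_circlepath_simple) auto
  then have "((\<lambda>\<theta>. \<i> * f (c + of_real \<rho> * cis \<theta>)) has_integral (2 * of_real pi * \<i> * f c)) {0..2*pi}"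
    using \<open>0 < \<rho>\<close> unfolding circlepath_def
    by (subst (asm) has_contour_integral_part_circlepath_iff) (auto simp: mult_ac)
  from has_integral_mult_right[OF this, of "- \<i>"] show ?thesis
    by (simp add: mult_ac)
qed

text \<open>
  For \<open>B > 0\<close> the function \<open>A ln \<bar>z\<bar> - B \<bar>z\<bar>\<^sup>2\<close> is strictly superharmonic off the origin: its mean falls
  below the central value by exactly \<open>B \<rho>\<^sup>2\<close>. On the circle itself, \<open>\<bar>z\<bar>\<^sup>2\<close> agrees with the real part of
  an affine function of \<open>z\<close>, so the integrand is the real part of one holomorphic function \<open>f\<close>. The
  quotient \<open>z / c\<close> stays in the right half plane, which keeps the logarithm on its principal branch.
\<close>
lemma log_perturbed_circle_mean:
  fixes c :: complex and A B \<rho> :: real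
  assumes \<rho>: "0 < \<rho>" "\<rho> < norm c"
  shows "((\<lambda>\<theta>. A * ln (norm (c + of_real \<rho> * cis \<theta>)) - B * (norm (c + of_real \<rho> * cis \<theta>))\<^sup>2)
           has_integral (2 * pi * (A * ln (norm c) - B * (norm c)\<^sup>2 - B * \<rho>\<^sup>2))) {0..2*pi}"
proof -
  have "c \<noteq> 0" using \<rho> by auto
  define f where "f z = of_real A * (Ln (z / c) + of_real (ln (norm c)))
     - of_real B * (of_real ((norm c)\<^sup>2 + \<rho>\<^sup>2) + 2 * cnj c * (z - c))" for z
  have slit: "z / c \<notin> \<real>\<^sub>\<le>\<^sub>0" if "z \<in> cball c \<rho>" for z
  proof -
    have "norm (z / c - 1) = norm (z - c) / norm c"
      using \<open>c \<noteq> 0\<close> by (simp add: diff_divide_distrib flip: norm_divide)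
    also have "\<dots> < 1"
      using that \<rho> by (simp add: dist_norm norm_minus_commute divide_simps)
    finally have "Re (z / c) > 0"
      using abs_Re_le_cmod[of "z / c - 1"] by simp
    then show ?thesis by (auto simp: complex_nonpos_Reals_iff)
  qed
  have "f holomorphic_on cball c \<rho>"
    unfolding f_def[abs_def] using slit \<open>c \<noteq> 0\<close> by (intro holomorphic_intros) auto
  from holomorphic_circle_mean[OF this \<rho>(1)]
  have "((\<lambda>\<theta>. Re (f (c + of_real \<rho> * cis \<theta>))) has_integral Re (of_real (2 * pi) * f c)) {0..2*pi}"
    by (rule has_integral_Re)
  moreover have "Re (f (c + of_real \<rho> * cis \<theta>)) =
      A * ln (norm (c + of_real \<rho> * cis \<theta>)) - B * (norm (c + of_real \<rho> * cis \<theta>))\<^sup>2" for \<theta>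
  proof -
    define z where "z = c + of_real \<rho> * cis \<theta>"
    have d: "norm (z - c) = \<rho>" using \<rho> by (simp add: z_def norm_mult)
    have "z \<noteq> 0" using d \<rho> by auto
    have "(norm z)\<^sup>2 = (norm c)\<^sup>2 + \<rho>\<^sup>2 + 2 * Re (cnj c * (z - c))"
      unfolding d[symmetric] cmod_power2 by (simp add: power2_eq_square algebra_simps)
    moreover have "Re (Ln (z / c)) = ln (norm z) - ln (norm c)"
      using \<open>z \<noteq> 0\<close> \<open>c \<noteq> 0\<close> by (simp add: norm_divide ln_div)
    moreover have "Re (f z) = A * (Re (Ln (z / c)) + ln (norm c))
        - B * ((norm c)\<^sup>2 + \<rho>\<^sup>2 + 2 * Re (cnj c * (z - c)))"
      by (simp add: f_def)
    ultimately show ?thesis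
      unfolding z_def[symmetric] by simp
  qed
  moreover have "Re (of_real (2 * pi) * f c) = 2 * pi * (A * ln (norm c) - B * (norm c)\<^sup>2 - B * \<rho>\<^sup>2)"
    using \<open>c \<noteq> 0\<close> by (simp add: f_def algebra_simps)
  ultimately show ?thesis by simp
qed

section \<open>The Bernstein-Walsh bound\<close>

text \<open>
  The maximum principle for \<open>v - (1 + \<epsilon>) ln \<bar>\<zeta>\<bar>\<close> on an annulus \<open>1 \<le> \<bar>\<zeta>\<bar> \<le> R\<close>. The surplus \<open>\<epsilon>\<close> makes the
  function small on the outer circle for large \<open>R\<close>. Adding \<open>\<eta> \<bar>\<zeta>\<bar>\<^sup>2\<close> makes the submean inequality strict,
  so that an interior maximum is impossible outright, with no need to discuss where equality holds in
  the mean value inequality.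
\<close>
lemma subharmonic_log_growth:
  fixes v :: "complex \<Rightarrow> ereal" and C c :: real
  assumes sh: "subharmonic v"
    and unit: "\<And>\<zeta>. norm \<zeta> = 1 \<Longrightarrow> v \<zeta> \<le> ereal C"
    and growth: "\<And>\<zeta>. v \<zeta> \<le> ereal (ln (max 1 (norm \<zeta>)) + c)"
    and \<zeta>0: "1 \<le> norm \<zeta>0"
  shows "v \<zeta>0 \<le> ereal (C + ln (norm \<zeta>0))"
proof (rule ccontr)
  assume "\<not> ?thesis"
  then have big: "ereal (C + ln (norm \<zeta>0)) < v \<zeta>0" by simp
  moreover have "v \<zeta>0 < \<infinity>" using sh by (simp add: subharmonic_def)
  ultimately obtain D where D: "v \<zeta>0 = ereal D" "C + ln (norm \<zeta>0) < D"
    by (cases "v \<zeta>0") auto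
  have "norm \<zeta>0 \<noteq> 1" using unit[of \<zeta>0] D by auto
  then have "1 < norm \<zeta>0" using \<zeta>0 by simp
  define L where "L = ln (norm \<zeta>0)"
  have "L > 0" unfolding L_def using \<open>1 < norm \<zeta>0\<close> by (rule ln_gt_zero)
  \<comment> \<open>Half of the assumed excess at \<open>\<zeta>0\<close> pays for \<open>\<epsilon>\<close>; the other half exceeds \<open>\<eta> R\<^sup>2\<close>.\<close>
  define \<gamma> where "\<gamma> = (D - C - L) / 2"
  have "\<gamma> > 0" using D by (simp add: \<gamma>_def L_def)
  define \<epsilon> where "\<epsilon> = \<gamma> / L"
  have "\<epsilon> > 0" using \<open>\<gamma> > 0\<close> \<open>L > 0\<close> by (simp add: \<epsilon>_def)
  have gap: "D - (1 + \<epsilon>) * L = C + \<gamma>"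
    using \<open>L > 0\<close> by (simp add: \<epsilon>_def \<gamma>_def field_simps)
  define R where "R = max (norm \<zeta>0 + 1) (exp ((c - C) / \<epsilon> + 1))"
  have R: "norm \<zeta>0 < R" "1 < R" using \<open>1 < norm \<zeta>0\<close> by (auto simp: R_def)
  have "(c - C) / \<epsilon> + 1 \<le> ln R"
    using R by (subst ln_ge_iff) (auto simp: R_def)
  then have lnR: "c - C < \<epsilon> * ln R"
    using \<open>\<epsilon> > 0\<close> by (simp add: field_simps)
  define \<eta> where "\<eta> = \<gamma> / (2 * R\<^sup>2)"
  have "\<eta> > 0" using \<open>\<gamma> > 0\<close> R by (simp add: \<eta>_def)
  have \<eta>R: "\<eta> * R\<^sup>2 < \<gamma>" using \<open>\<gamma> > 0\<close> R by (simp add: \<eta>_def)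
  \<comment> \<open>The truncation by 1 leaves \<open>k\<close> unchanged on the annulus and makes it continuous on the whole plane.\<close>
  define k where "k \<zeta> = \<eta> * (norm \<zeta>)\<^sup>2 - (1 + \<epsilon>) * ln (max 1 (norm \<zeta>))" for \<zeta> :: complex
  have contk: "continuous_on A k" for A
    unfolding k_def[abs_def] by (intro continuous_intros) auto
  define K where "K = cball 0 R - ball (0::complex) 1"
  have K: "\<zeta> \<in> K \<longleftrightarrow> 1 \<le> norm \<zeta> \<and> norm \<zeta> \<le> R" for \<zeta> by (auto simp: K_def)
  have "compact K" unfolding K_def by (intro compact_diff) auto
  moreover have "\<zeta>0 \<in> K" using K R \<zeta>0 by simp
  moreover have "upper_semicontinuous (\<lambda>\<zeta>. v \<zeta> + ereal (k \<zeta>))"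
    using sh contk by (intro upper_semicontinuous_add_continuous) (auto simp: subharmonic_def)
  ultimately obtain w where w: "w \<in> K" and
    wmax: "\<And>\<zeta>. \<zeta> \<in> K \<Longrightarrow> v \<zeta> + ereal (k \<zeta>) \<le> v w + ereal (k w)"
    using upper_semicontinuous_attains_max[of "\<lambda>\<zeta>. v \<zeta> + ereal (k \<zeta>)" K] by blast
  have "C + \<gamma> \<le> D + k \<zeta>0"
  proof -
    have "k \<zeta>0 = \<eta> * (norm \<zeta>0)\<^sup>2 - (1 + \<epsilon>) * L"
      using \<zeta>0 by (simp add: k_def L_def max_absorb2)
    moreover have "0 \<le> \<eta> * (norm \<zeta>0)\<^sup>2" using \<open>\<eta> > 0\<close> by simp
    ultimately show ?thesis using gap by linarith
  qed
  with \<eta>R have "ereal (C + \<eta> * R\<^sup>2) < v \<zeta>0 + ereal (k \<zeta>0)" using D by simp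
  also note wmax[OF \<open>\<zeta>0 \<in> K\<close>]
  finally have wbig: "ereal (C + \<eta> * R\<^sup>2) < v w + ereal (k w)" .
  moreover have "v w < \<infinity>" using sh by (simp add: subharmonic_def)
  ultimately obtain V where V: "v w = ereal V" by (cases "v w") auto
  with wbig have Vbig: "C + \<eta> * R\<^sup>2 < V + k w" by simp
  have "norm w \<noteq> 1"
  proof
    assume "norm w = 1"
    then have "V \<le> C" "k w = \<eta>" using unit[of w] V by (auto simp: k_def)
    moreover have "\<eta> \<le> \<eta> * R\<^sup>2" using \<open>\<eta> > 0\<close> R by simp
    ultimately show False using Vbig by simp
  qed
  moreover have "norm w \<noteq> R"
  proof
    assume "norm w = R"
    then have "V \<le> ln R + c" "k w = \<eta> * R\<^sup>2 - (1 + \<epsilon>) * ln R"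
      using growth[of w] V R by (auto simp: k_def max_absorb2)
    then show False using Vbig lnR by (simp add: algebra_simps)
  qed
  ultimately have wK: "1 < norm w" "norm w < R" using w K[of w] by auto
  define \<rho> where "\<rho> = min (norm w - 1) (R - norm w)"
  have \<rho>: "0 < \<rho>" "\<rho> < norm w" using wK by (auto simp: \<rho>_def)
  have circ: "w + of_real \<rho> * cis \<theta> \<in> K" for \<theta>
  proof -
    have "norm (of_real \<rho> * cis \<theta>) = \<rho>" using \<rho> by (simp add: norm_mult)
    then have "norm w - \<rho> \<le> norm (w + of_real \<rho> * cis \<theta>)" "norm (w + of_real \<rho> * cis \<theta>) \<le> norm w + \<rho>"
      using norm_triangle_ineq[of w "of_real \<rho> * cis \<theta>"] norm_diff_ineq[of w "of_real \<rho> * cis \<theta>"] by auto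
    then show ?thesis unfolding K \<rho>_def by linarith
  qed
  \<comment> \<open>Maximality of \<open>w\<close> says that \<open>h\<close> majorises \<open>v\<close> on the circle, but the mean of \<open>h\<close> is below \<open>V\<close>.\<close>
  define h where "h \<theta> = (V + k w) - k (w + of_real \<rho> * cis \<theta>)" for \<theta>
  have h_eq: "h \<theta> = (V + k w) + ((1 + \<epsilon>) * ln (norm (w + of_real \<rho> * cis \<theta>))
        - \<eta> * (norm (w + of_real \<rho> * cis \<theta>))\<^sup>2)" for \<theta>
    using circ[of \<theta>] by (simp add: h_def k_def K max_absorb2)
  have "(h has_integral (2 * pi * (V + k w) +
      2 * pi * ((1 + \<epsilon>) * ln (norm w) - \<eta> * (norm w)\<^sup>2 - \<eta> * \<rho>\<^sup>2))) {0..2*pi}"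
    unfolding h_eq[abs_def]
    using has_integral_const_real[of "V + k w" 0 "2*pi"]
    by (intro has_integral_add log_perturbed_circle_mean \<rho>) simp
  moreover have "k w = \<eta> * (norm w)\<^sup>2 - (1 + \<epsilon>) * ln (norm w)"
    using wK by (simp add: k_def max_absorb2)
  ultimately have hint: "(h has_integral 2 * pi * (V - \<eta> * \<rho>\<^sup>2)) {0..2*pi}"
    by (simp add: algebra_simps)
  have "circle_mean v w \<rho> \<le> ereal (2 * pi * (V - \<eta> * \<rho>\<^sup>2) / (2*pi))"
  proof (rule circle_mean_le_integral_mean[OF _ hint])
    show "continuous_on {0..2*pi} h"
      unfolding h_def[abs_def]
      by (intro continuous_intros continuous_on_compose2[OF contk[of UNIV]]) auto
    show "v (w + of_real \<rho> * cis \<theta>) \<le> ereal (h \<theta>)" for \<theta>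
      using wmax[OF circ[of \<theta>]] V
      by (cases "v (w + of_real \<rho> * cis \<theta>)") (auto simp: h_def)
  qed
  moreover have "v w \<le> circle_mean v w \<rho>" using sh \<rho> by (simp add: subharmonic_def)
  ultimately have "ereal V \<le> ereal (2 * pi * (V - \<eta> * \<rho>\<^sup>2) / (2*pi))"
    unfolding V by (rule order_trans[rotated])
  then have "\<eta> * \<rho>\<^sup>2 \<le> 0" by simp
  moreover have "0 < \<eta> * \<rho>\<^sup>2" using \<open>\<eta> > 0\<close> \<rho> by simp
  ultimately show False by simp
qed

lemma norm_complex_vector_scalar_mult: "norm (w *s d) = norm w * norm d"
  for d :: "complex ^ 'n"
  by (simp add: norm_vec_def L2_set_def norm_mult power_mult_distrib flip: sum_distrib_left
      add: real_sqrt_mult)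

lemma max_0_ln: "max 0 (ln x) = ln (max 1 x)" if "0 \<le> x" for x :: real
  using that by (cases "x \<le> 1"; cases "x = 0") (auto simp: max_def)

lemma ln_max_affine_le:
  fixes s t x :: real
  assumes "0 \<le> s" "0 \<le> t" "0 \<le> x"
  shows "ln (max 1 (s + t * x)) \<le> ln (max 1 x) + ln (1 + s + t)"
proof -
  have "s * 1 \<le> s * max 1 x" "t * x \<le> t * max 1 x"
    using assms by (intro mult_left_mono; simp)+
  then have "max 1 (s + t * x) \<le> max 1 x * (1 + s + t)"
  proof -
    have "0 \<le> s * max 1 x" "0 \<le> t * max 1 x" using assms by auto
    moreover have "max 1 x * (1 + s + t) = max 1 x + s * max 1 x + t * max 1 x"
      by (simp add: algebra_simps)
    moreover have "1 \<le> max 1 x" by simp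
    ultimately show ?thesis
      using \<open>s * 1 \<le> _\<close> \<open>t * x \<le> _\<close> by (intro max.boundedI) linarith+
  qed
  then have "ln (max 1 (s + t * x)) \<le> ln (max 1 x * (1 + s + t))" by simp
  also have "\<dots> = ln (max 1 x) + ln (1 + s + t)"
    using assms by (simp add: ln_mult)
  finally show ?thesis .
qed

lemma lelong_class_growth:
  assumes "u \<in> lelong_class"
  obtains c where "\<And>z. u z \<le> ereal (ln (max 1 (norm z)) + c)"
  using assms unfolding lelong_class_def by (auto simp: max_0_ln)

text \<open>
  The growth condition survives composition with maps of at most linear growth. It is needed both for
  restrictions to complex lines and for dilations.
\<close>
lemma lelong_class_affine_growth:
  assumes u: "u \<in> lelong_class"
    and g: "\<And>x. norm (g x) \<le> s + t * norm x" and "0 \<le> s" "0 \<le> t"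
  obtains c where "\<And>x. u (g x) \<le> ereal (ln (max 1 (norm x)) + c)"
proof -
  obtain c where c: "\<And>z. u z \<le> ereal (ln (max 1 (norm z)) + c)"
    using lelong_class_growth[OF u] by blast
  have "u (g x) \<le> ereal (ln (max 1 (norm x)) + (ln (1 + s + t) + c))" for x
  proof -
    have "ln (max 1 (norm (g x))) \<le> ln (max 1 (s + t * norm x))"
      using g[of x] by simp
    also have "\<dots> \<le> ln (max 1 (norm x)) + ln (1 + s + t)"
      using assms by (intro ln_max_affine_le) auto
    finally show ?thesis
      by (intro order_trans[OF c[of "g x"]]) simp
  qed
  with that show ?thesis by blast
qed

text \<open>
  Along the complex line through \<open>b\<close> and \<open>z\<close>, parametrised with a unit direction, the distance to \<open>b\<close>
  is the modulus of the parameter, so the one-variable bound applies.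
\<close>
lemma lelong_class_bound_outside_ball:
  assumes u: "u \<in> lelong_class" and C: "\<And>x. norm (x - b) \<le> 1 \<Longrightarrow> u x \<le> ereal C"
    and z: "1 \<le> norm (z - b)"
  shows "u z \<le> ereal (C + ln (norm (z - b)))"
proof -
  define s where "s = norm (z - b)"
  define d where "d = complex_of_real (1 / s) *s (z - b)"
  have "s > 0" using z unfolding s_def by linarith
  have nd: "norm d = 1"
    unfolding d_def norm_complex_vector_scalar_mult s_def[symmetric]
    using \<open>s > 0\<close> by (simp add: norm_divide)
  have zd: "z = b + complex_of_real s *s d"
    using \<open>s > 0\<close> by (simp add: d_def vec_eq_iff)
  have "norm (b + \<zeta> *s d) \<le> norm b + 1 * norm \<zeta>" for \<zeta>
    using norm_triangle_ineq[of b "\<zeta> *s d"] nd by (simp add: norm_complex_vector_scalar_mult)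
  then obtain c where c: "\<And>\<zeta>. u (b + \<zeta> *s d) \<le> ereal (ln (max 1 (norm \<zeta>)) + c)"
    by (rule lelong_class_affine_growth[OF u]) auto
  have "u (b + complex_of_real s *s d) \<le> ereal (C + ln (norm (complex_of_real s)))"
  proof (rule subharmonic_log_growth[where v = "\<lambda>\<zeta>. u (b + \<zeta> *s d)"])
    show "subharmonic (\<lambda>\<zeta>. u (b + \<zeta> *s d))"
      using u by (simp add: lelong_class_def plurisubharmonic_def)
    show "u (b + \<zeta> *s d) \<le> ereal C" if "norm \<zeta> = 1" for \<zeta>
      using that nd by (intro C) (simp add: norm_complex_vector_scalar_mult)
    show "u (b + \<zeta> *s d) \<le> ereal (ln (max 1 (norm \<zeta>)) + c)" for \<zeta> by (rule c)
    show "1 \<le> norm (complex_of_real s)" using z by (simp add: s_def)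
  qed
  then show ?thesis using \<open>s > 0\<close> by (simp add: zd[symmetric]) (simp add: s_def)
qed

lemma extremal_fun_bound_outside_ball:
  assumes C: "\<And>x. norm (x - b) \<le> 1 \<Longrightarrow> extremal_fun F x \<le> ereal C"
    and z: "1 \<le> norm (z - b)"
  shows "extremal_fun F z \<le> ereal (C + ln (norm (z - b)))"
  unfolding extremal_fun_def
proof (rule SUP_least)
  fix u :: "complex ^ 'a \<Rightarrow> ereal" assume u: "u \<in> {u \<in> lelong_class. \<forall>x\<in>F. u x \<le> 0}"
  have "u x \<le> extremal_fun F x" for x
    unfolding extremal_fun_def by (rule SUP_upper[OF u])
  then show "u z \<le> ereal (C + ln (norm (z - b)))"
    using u C z by (intro lelong_class_bound_outside_ball) (auto intro: order_trans)
qed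

section \<open>Dilations\<close>

lemma lelong_class_dilation:
  fixes b :: "complex ^ 'n"
  assumes u: "u \<in> lelong_class"
  shows "(\<lambda>x. u (b + t *\<^sub>R (x - b))) \<in> lelong_class"
proof -
  have usc: "upper_semicontinuous (\<lambda>x. u (b + t *\<^sub>R (x - b)))"
    unfolding upper_semicontinuous_def
  proof
    fix c
    have "open {x. u x < c}"
      using u by (simp add: lelong_class_def plurisubharmonic_def upper_semicontinuous_def)
    then have "open ((\<lambda>x. b + t *\<^sub>R (x - b)) -` {x. u x < c})"
      by (rule open_vimage) (intro continuous_intros)
    then show "open {x. u (b + t *\<^sub>R (x - b)) < c}" by (simp add: vimage_def)
  qed
  have line: "b + t *\<^sub>R (a + w *s d - b) = (b + t *\<^sub>R (a - b)) + w *s (t *\<^sub>R d)" for a d w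
    by (simp add: vec_eq_iff algebra_simps)
  have sh: "subharmonic (\<lambda>w. u (b + t *\<^sub>R (a + w *s d - b)))" for a d
    using u unfolding line by (simp add: lelong_class_def plurisubharmonic_def)
  have fin: "u z < \<infinity>" for z
    using u by (simp add: lelong_class_def plurisubharmonic_def)
  have "norm (b + t *\<^sub>R (x - b)) \<le> (norm b + \<bar>t\<bar> * norm b) + \<bar>t\<bar> * norm x" for x
  proof -
    have "norm (b + t *\<^sub>R (x - b)) \<le> norm b + \<bar>t\<bar> * norm (x - b)"
      using norm_triangle_ineq[of b "t *\<^sub>R (x - b)"] by simp
    also have "\<bar>t\<bar> * norm (x - b) \<le> \<bar>t\<bar> * (norm x + norm b)"
      by (intro mult_left_mono norm_triangle_ineq4) auto
    finally show ?thesis by (simp add: algebra_simps)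
  qed
  then obtain c where c: "\<And>x. u (b + t *\<^sub>R (x - b)) \<le> ereal (ln (max 1 (norm x)) + c)"
    by (rule lelong_class_affine_growth[OF u]) auto
  show ?thesis
    unfolding lelong_class_def plurisubharmonic_def
    using usc sh fin c by (auto simp: max_0_ln)
qed

text \<open>Competitors for \<open>E\<close> pull back under the dilation to competitors for \<open>F\<close>.\<close>
lemma extremal_fun_dilation_le:
  assumes "\<And>x. x \<in> F \<Longrightarrow> b + t *\<^sub>R (x - b) \<in> E"
  shows "extremal_fun E (b + t *\<^sub>R (x - b)) \<le> extremal_fun F x"
  unfolding extremal_fun_def
proof (rule SUP_least)
  fix u :: "complex ^ 'a \<Rightarrow> ereal" assume "u \<in> {u \<in> lelong_class. \<forall>x\<in>E. u x \<le> 0}"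
  with assms have "(\<lambda>x. u (b + t *\<^sub>R (x - b))) \<in> {u \<in> lelong_class. \<forall>x\<in>F. u x \<le> 0}"
    using lelong_class_dilation by blast
  then show "u (b + t *\<^sub>R (x - b)) \<le> (SUP u \<in> {u \<in> lelong_class. \<forall>x\<in>F. u x \<le> 0}. u x)"
    by (rule SUP_upper2) simp
qed

section \<open>Local Hoelder continuity at star centers\<close>

text \<open>
  Extends the Hoelder estimate at \<open>b\<close> from radii \<open>s \<le> 1\<close> to all radii. For \<open>s > 1\<close> the logarithmic growth
  of the extremal function is absorbed by the power through \<open>ln s \<le> s\<^sup>\<mu> / \<mu>\<close>, which accounts for the
  summand \<open>1 / \<mu>\<close> in the constant.
\<close>
lemma extremal_fun_power_growth:
  assumes "0 < \<mu>" "0 \<le> C"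
    and C: "\<And>\<delta> z. \<lbrakk>0 < \<delta>; \<delta> \<le> 1; norm (z - b) \<le> \<delta>\<rbrakk> \<Longrightarrow> extremal_fun F z \<le> ereal (C * \<delta> powr \<mu>)"
    and "0 < s" "norm (z - b) \<le> s"
  shows "extremal_fun F z \<le> ereal ((C + 1 / \<mu>) * s powr \<mu>)"
proof -
  have weaken: "C * s powr \<mu> \<le> (C + 1 / \<mu>) * s powr \<mu>"
    using \<open>0 < \<mu>\<close> by (intro mult_right_mono) auto
  consider "s \<le> 1" | "1 < s" "norm (z - b) \<le> 1" | "1 < s" "1 < norm (z - b)" by linarith
  then show ?thesis
  proof cases
    case 1
    then have "extremal_fun F z \<le> ereal (C * s powr \<mu>)" using assms by blast
    also have "\<dots> \<le> ereal ((C + 1 / \<mu>) * s powr \<mu>)" using weaken by simp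
    finally show ?thesis .
  next
    case 2
    then have "extremal_fun F z \<le> ereal C" using C[of 1 z] by simp
    also have "C * 1 \<le> C * s powr \<mu>"
      using 2 \<open>0 < \<mu>\<close> \<open>0 \<le> C\<close> by (intro mult_left_mono ge_one_powr_ge_zero) auto
    then have "ereal C \<le> ereal ((C + 1 / \<mu>) * s powr \<mu>)" using weaken by simp
    finally show ?thesis .
  next
    case 3
    have "extremal_fun F z \<le> ereal (C + ln (norm (z - b)))"
      using 3 C[of 1] by (intro extremal_fun_bound_outside_ball) auto
    also have "C + ln (norm (z - b)) \<le> C * s powr \<mu> + s powr \<mu> / \<mu>"
    proof (rule add_mono)
      have "C * 1 \<le> C * s powr \<mu>"
        using 3 \<open>0 < \<mu>\<close> \<open>0 \<le> C\<close> by (intro mult_left_mono ge_one_powr_ge_zero) auto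
      then show "C \<le> C * s powr \<mu>" by simp
      have "ln (norm (z - b)) \<le> ln s" using 3 assms(5) by (intro ln_mono) linarith+
      also have "\<dots> \<le> s powr \<mu> / \<mu>" using 3 \<open>0 < \<mu>\<close> by (intro ln_powr_bound) auto
      finally show "ln (norm (z - b)) \<le> s powr \<mu> / \<mu>" .
    qed
    then have "ereal (C + ln (norm (z - b))) \<le> ereal ((C + 1 / \<mu>) * s powr \<mu>)"
      by (simp add: algebra_simps)
    finally show ?thesis .
  qed
qed

text \<open>
  The quantitative form behind both assertions: the constant is explicit and depends on \<open>b\<close> only
  through \<open>C\<close> and \<open>R\<close>, so it is uniform whenever these are.
\<close>
lemma extremal_modulus_star_center:
  assumes "0 < \<mu>" "0 \<le> C"
    and C: "\<And>\<delta> z. \<lbrakk>0 < \<delta>; \<delta> \<le> 1; norm (z - b) \<le> \<delta>\<rbrakk> \<Longrightarrow> extremal_fun F z \<le> ereal (C * \<delta> powr \<mu>)"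
    and star: "star_center F b"
    and R: "1 \<le> R" "F \<subseteq> cball b R"
    and \<delta>: "0 < \<delta>" and r: "0 < r" "r \<le> 1"
  shows "extremal_modulus (F \<inter> cball b r) b \<delta> \<le> ereal ((C + 1 / \<mu>) * R powr \<mu> * \<delta> powr \<mu> / r powr \<mu>)"
  unfolding extremal_modulus_def
proof (rule SUP_least)
  fix z assume "z \<in> cball b \<delta>"
  define t where "t = r / R"
  have t: "0 < t" "t \<le> 1" using r R by (auto simp: t_def)
  have into: "b + t *\<^sub>R (x - b) \<in> F \<inter> cball b r" if "x \<in> F" for x
  proof
    have "b + t *\<^sub>R (x - b) = t *\<^sub>R x + (1 - t) *\<^sub>R b" by (simp add: algebra_simps)
    then show "b + t *\<^sub>R (x - b) \<in> F"
      using star t that unfolding star_center_def by (simp add: image_subset_iff)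
    have "norm (x - b) \<le> R" using that R by (auto simp: dist_norm norm_minus_commute)
    then have "t * norm (x - b) \<le> t * R" using t by (intro mult_left_mono) auto
    then show "b + t *\<^sub>R (x - b) \<in> cball b r" using r R by (simp add: dist_norm t_def)
  qed
  define y where "y = b + (1 / t) *\<^sub>R (z - b)"
  have z: "z = b + t *\<^sub>R (y - b)" using t by (simp add: y_def)
  have "norm (y - b) \<le> \<delta> / t"
    using \<open>z \<in> cball b \<delta>\<close> t by (simp add: y_def dist_norm norm_minus_commute divide_right_mono)
  have "extremal_fun (F \<inter> cball b r) z \<le> extremal_fun F y"
    unfolding z using into by (rule extremal_fun_dilation_le)
  also have "\<dots> \<le> ereal ((C + 1 / \<mu>) * (\<delta> / t) powr \<mu>)"
    using assms t \<open>norm (y - b) \<le> \<delta> / t\<close> by (intro extremal_fun_power_growth[where b = b]) auto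
  also have "(C + 1 / \<mu>) * (\<delta> / t) powr \<mu> = (C + 1 / \<mu>) * R powr \<mu> * \<delta> powr \<mu> / r powr \<mu>"
    using r R \<delta> by (simp add: t_def powr_divide powr_mult mult_ac)
  finally show "extremal_fun (F \<inter> cball b r) z
      \<le> ereal ((C + 1 / \<mu>) * R powr \<mu> * \<delta> powr \<mu> / r powr \<mu>)" .
qed

lemma convex_imp_star_center:
  assumes "convex F" "b \<in> F"
  shows "star_center F b"
  using assms unfolding star_center_def by (auto intro: convexD)

theorem theorem1p7:
  fixes F :: "(complex ^ 'n) set" and \<mu> \<nu> :: real
  assumes "compact F"
    and "0 < \<mu>" and "\<mu> \<le> 1"
    and "0 < \<nu>" and "\<nu> \<le> 1"
  shows "(convex F \<and> HCP \<mu> F \<longrightarrow> local_HCP \<mu> \<mu> F) \<and>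
    (\<forall>b\<in>F. HCP_at \<nu> F b \<and> star_center F b \<longrightarrow> local_HCP_at \<nu> \<nu> F b)"
proof -
  define R where "R = max 1 (diameter F)"
  have R: "1 \<le> R" "F \<subseteq> cball b R" if "b \<in> F" for b
    using diameter_bounded_bound[OF compact_imp_bounded[OF \<open>compact F\<close>] that]
    by (auto simp: R_def le_max_iff_disj)
  have "1 \<le> R" by (simp add: R_def)
  have "local_HCP \<mu> \<mu> F" if "convex F" "HCP \<mu> F"
  proof -
    obtain C where "C > 0" and C: "\<And>\<delta> z. \<lbrakk>0 < \<delta>; \<delta> \<le> 1; z \<in> closed_nbhd F \<delta>\<rbrakk>
        \<Longrightarrow> extremal_fun F z \<le> ereal (C * \<delta> powr \<mu>)"
      using \<open>HCP \<mu> F\<close> unfolding HCP_def by blast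
    have at: "extremal_fun F z \<le> ereal (C * \<delta> powr \<mu>)"
      if "b \<in> F" "0 < \<delta>" "\<delta> \<le> 1" "norm (z - b) \<le> \<delta>" for b z \<delta>
      using that by (intro C) (auto simp: closed_nbhd_def dist_norm norm_minus_commute)
    have "(C + 1 / \<mu>) * R powr \<mu> > 0"
      using \<open>C > 0\<close> \<open>0 < \<mu>\<close> \<open>1 \<le> R\<close> by (intro mult_pos_pos add_pos_pos) auto
    moreover have "extremal_modulus (F \<inter> cball a r) a \<delta>
        \<le> ereal ((C + 1 / \<mu>) * R powr \<mu> * \<delta> powr \<mu> / r powr \<mu>)"
      if "a \<in> F" "0 < \<delta>" "0 < r" "r \<le> 1" for a \<delta> r
      using that \<open>0 < \<mu>\<close> \<open>C > 0\<close> R at convex_imp_star_center[OF \<open>convex F\<close>]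
      by (intro extremal_modulus_star_center) auto
    ultimately show ?thesis unfolding local_HCP_def by blast
  qed
  moreover have "local_HCP_at \<nu> \<nu> F b" if "b \<in> F" "HCP_at \<nu> F b" "star_center F b" for b
  proof -
    obtain C where "C > 0" and C: "\<And>\<delta> z. \<lbrakk>0 < \<delta>; \<delta> \<le> 1; norm (z - b) \<le> \<delta>\<rbrakk>
        \<Longrightarrow> extremal_fun F z \<le> ereal (C * \<delta> powr \<nu>)"
      using \<open>HCP_at \<nu> F b\<close> unfolding HCP_at_def by blast
    have "(C + 1 / \<nu>) * R powr \<nu> > 0"
      using \<open>C > 0\<close> \<open>0 < \<nu>\<close> \<open>1 \<le> R\<close> by (intro mult_pos_pos add_pos_pos) auto
    moreover have "extremal_modulus (F \<inter> cball b r) b \<delta>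
        \<le> ereal ((C + 1 / \<nu>) * R powr \<nu> * \<delta> powr \<nu> / r powr \<nu>)"
      if "0 < \<delta>" "0 < r" "r \<le> 1" for \<delta> r
      using that \<open>0 < \<nu>\<close> \<open>C > 0\<close> R[OF \<open>b \<in> F\<close>] C \<open>star_center F b\<close>
      by (intro extremal_modulus_star_center) auto
    ultimately show ?thesis unfolding local_HCP_at_def by blast
  qed
  ultimately show ?thesis by blast
qed

end
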